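(* Let $T$ be a rooted, countably infinite tree without terminal vertices. Let $\varphi:T\to\mathbb C$ be a function such that $\varphi$ and $\varphi'$ are both in $\mathcal L^1(T)$. Then the Toeplitz operator $T_\varphi$ is bounded on $\mathcal L^\infty(T)$, and its spectrum as a bounded operator on $\mathcal L^\infty(T)$ is $$\sigma(T_{\varphi})=\mathrm{clos}\{\varphi(v):v\in T\},$$ the closure in $\mathbb C$ of the range of $\varphi$.
   Context: A tree $T$ is a locally finite graph (every vertex has finitely many neighbors) in which any two vertices are joined by exactly one path (a finite sequence of distinct, successively adjacent vertices); $T$ is identified with its set of vertices. The set of vertices is countably infinite, and a distinguished vertex $o$ is called the root. A terminal vertex is a vertex with exactly one neighbor; $T$ is assumed to have none. A vertex $w$ is a descendant of $v$ if $v$ lies on the path from $o$ to $w$. For $v\neq o$, $v^-$ denotes the unique neighbor of $v$ lying on the path from $o$ to $v$ (the parent of $v$). The sector $S_v$ is the set consisting of $v$ and all its descendants. $\mathcal L^1(T)$ is the Banach space of functions $f:T\to\mathbb C$ with $\|f\|_1=\sum_{v\in T}|f(v)|<\infty$; $\mathcal L^\infty(T)$ is the Banach space of bounded functions $f:T\to\mathbb C$ with the supremum norm. For $\varphi:T\to\mathbb C$, define $\varphi_-(v)=\varphi(v^-)$ if $v\ne o$, $\varphi_-(o)=0$, and $\varphi'(v)=\varphi(v)-\varphi_-(v)$ for all $v\in T$ (so $\varphi'(o)=\varphi(o)$). For any $f:T\to\mathbb C$, define $(\nabla f)(u)=f(u)-\sum_{v:\,v^-=u}f(v)$, $u\in T$.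 For $f\in\mathcal L^1(T)$, define $(\Delta f)(u)=\sum_{v\in S_u}f(v)$, $u\in T$. The Toeplitz operator with symbol $\varphi$ on $\mathcal L^\infty(T)$ is $T_\varphi f=\Delta(\varphi\nabla f)$, $f\in\mathcal L^\infty(T)$. (It is known that $\varphi\nabla f\in\mathcal L^1(T)$ whenever $\varphi,\varphi'\in\mathcal L^1(T)$ and $f\in\mathcal L^\infty(T)$, so that this is well defined.) *)

theory Defs
  imports "HOL-Analysis.Analysis"
begin

text \<open>
  A tree is given by its adjacency relation on a type \<open>'v\<close>, all of whose elements are vertices.
\<close>

definition is_path :: "('v \<Rightarrow> 'v \<Rightarrow> bool) \<Rightarrow> 'v \<Rightarrow> 'v \<Rightarrow> 'v list \<Rightarrow> bool" where
  "is_path adj u v p \<longleftrightarrow>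
     p \<noteq> [] \<and> hd p = u \<and> last p = v \<and> distinct p \<and> successively adj p"

definition is_tree :: "('v \<Rightarrow> 'v \<Rightarrow> bool) \<Rightarrow> bool" where
  "is_tree adj \<longleftrightarrow>
     symp adj \<and> irreflp adj \<and> (\<forall>v. finite {w. adj v w}) \<and> (\<forall>u v. \<exists>!p. is_path adj u v p)"

definition terminal_vertex :: "('v \<Rightarrow> 'v \<Rightarrow> bool) \<Rightarrow> 'v \<Rightarrow> bool" where
  "terminal_vertex adj v \<longleftrightarrow> (\<exists>!w. adj v w)"

definition tree_path :: "('v \<Rightarrow> 'v \<Rightarrow> bool) \<Rightarrow> 'v \<Rightarrow> 'v \<Rightarrow> 'v list" where
  "tree_path adj u v = (THE p. is_path adj u v p)"

text \<open>In what follows \<open>r\<close> is the root.\<close>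

definition descendant :: "('v \<Rightarrow> 'v \<Rightarrow> bool) \<Rightarrow> 'v \<Rightarrow> 'v \<Rightarrow> 'v \<Rightarrow> bool" where
  "descendant adj r v w \<longleftrightarrow> v \<in> set (tree_path adj r w)"

text \<open>Meaningful only for \<open>v \<noteq> r\<close>; every use below excludes the root.\<close>

definition parent :: "('v \<Rightarrow> 'v \<Rightarrow> bool) \<Rightarrow> 'v \<Rightarrow> 'v \<Rightarrow> 'v" where
  "parent adj r v = (THE u. adj v u \<and> u \<in> set (tree_path adj r v))"

definition sector :: "('v \<Rightarrow> 'v \<Rightarrow> bool) \<Rightarrow> 'v \<Rightarrow> 'v \<Rightarrow> 'v set" where
  "sector adj r v = insert v {w. descendant adj r v w}"

definition L1 :: "('v \<Rightarrow> complex) set" where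
  "L1 = {f. (\<lambda>v. norm (f v)) summable_on UNIV}"

definition Linf :: "('v \<Rightarrow> complex) set" where
  "Linf = {f. bounded (range f)}"

definition Linf_norm :: "('v \<Rightarrow> complex) \<Rightarrow> real" where
  "Linf_norm f = (SUP v. norm (f v))"

definition backshift :: "('v \<Rightarrow> 'v \<Rightarrow> bool) \<Rightarrow> 'v \<Rightarrow> ('v \<Rightarrow> complex) \<Rightarrow> 'v \<Rightarrow> complex" where
  "backshift adj r \<phi> v = (if v = r then 0 else \<phi> (parent adj r v))"

definition tree_deriv :: "('v \<Rightarrow> 'v \<Rightarrow> bool) \<Rightarrow> 'v \<Rightarrow> ('v \<Rightarrow> complex) \<Rightarrow> 'v \<Rightarrow> complex" where
  "tree_deriv adj r \<phi> v = \<phi> v - backshift adj r \<phi> v"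

definition nabla :: "('v \<Rightarrow> 'v \<Rightarrow> bool) \<Rightarrow> 'v \<Rightarrow> ('v \<Rightarrow> complex) \<Rightarrow> 'v \<Rightarrow> complex" where
  "nabla adj r f u = f u - (\<Sum>v | v \<noteq> r \<and> parent adj r v = u. f v)"

text \<open>The intended domain of \<open>Delta\<close> is \<open>L1\<close>.\<close>

definition Delta :: "('v \<Rightarrow> 'v \<Rightarrow> bool) \<Rightarrow> 'v \<Rightarrow> ('v \<Rightarrow> complex) \<Rightarrow> 'v \<Rightarrow> complex" where
  "Delta adj r f u = (\<Sum>\<^sub>\<infinity>v\<in>sector adj r u. f v)"

definition toeplitz ::
  "('v \<Rightarrow> 'v \<Rightarrow> bool) \<Rightarrow> 'v \<Rightarrow> ('v \<Rightarrow> complex) \<Rightarrow> ('v \<Rightarrow> complex) \<Rightarrow> 'v \<Rightarrow> complex" where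
  "toeplitz adj r \<phi> f = Delta adj r (\<lambda>v. \<phi> v * nabla adj r f v)"

text \<open>
  An operator on the subspace \<open>Linf\<close> is represented by a function on all of \<open>'v \<Rightarrow> complex\<close>, of which
  only the values on \<open>Linf\<close> matter. Linearity is over the complex numbers.
\<close>

definition Linf_bounded_op :: "(('v \<Rightarrow> complex) \<Rightarrow> 'v \<Rightarrow> complex) \<Rightarrow> bool" where
  "Linf_bounded_op A \<longleftrightarrow>
     (\<forall>f\<in>Linf. A f \<in> Linf) \<and>
     (\<forall>f\<in>Linf. \<forall>g\<in>Linf. A (\<lambda>v. f v + g v) = (\<lambda>v. A f v + A g v)) \<and>
     (\<forall>c. \<forall>f\<in>Linf. A (\<lambda>v. c * f v) = (\<lambda>v. c * A f v)) \<and>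
     (\<exists>K. \<forall>f\<in>Linf. Linf_norm (A f) \<le> K * Linf_norm f)"

definition Linf_invertible :: "(('v \<Rightarrow> complex) \<Rightarrow> 'v \<Rightarrow> complex) \<Rightarrow> bool" where
  "Linf_invertible A \<longleftrightarrow>
     (\<exists>B. Linf_bounded_op B \<and> (\<forall>f\<in>Linf. B (A f) = f \<and> A (B f) = f))"

definition Linf_spectrum :: "(('v \<Rightarrow> complex) \<Rightarrow> 'v \<Rightarrow> complex) \<Rightarrow> complex set" where
  "Linf_spectrum A = {z. \<not> Linf_invertible (\<lambda>f v. A f v - z * f v)}"

end

theory Submission
  imports Defs
begin

text \<open>
  Let \<open>f\<close> be the indicator function of the path from the root to \<open>v\<close>. Then \<open>\<nabla>f\<close> is the point mass
  at \<open>v\<close>. Hence \<open>f\<close> is an eigenvector of \<open>T\<^sub>\<phi>\<close> with eigenvalue \<open>\<phi>(v)\<close>, and these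
  eigenvectors, all of norm 1, are approximate eigenvectors for every point of the closure of the
  range. The same identity, summed against \<open>g\<close>, gives \<open>\<nabla>\<Delta>g = g\<close> on \<open>L\<^sup>1\<close>, whence
  \<open>T\<^sub>\<psi> T\<^sub>\<phi> = T\<^sub>\<psi>\<^sub>\<phi>\<close>. If \<open>\<lambda>\<close> is not in the closure of the range of \<open>\<phi>\<close>, then \<open>\<lambda> \<noteq> 0\<close> because
  \<open>\<phi>\<close> is summable on an infinite set, and the inverse of \<open>T\<^sub>\<phi> - \<lambda>\<close> is \<open>T\<^sub>\<psi> - 1/\<lambda>\<close> with
  \<open>\<psi> = 1/(\<phi> - \<lambda>) + 1/\<lambda> = \<phi>/(\<lambda>(\<phi> - \<lambda>))\<close>.
\<close>

section \<open>Summable and bounded functions\<close>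

lemma has_sum_finite_sum:
  fixes f :: "'a \<Rightarrow> 'b \<Rightarrow> 'c::topological_comm_monoid_add"
  assumes "finite A" "\<And>a. a \<in> A \<Longrightarrow> (f a has_sum s a) B"
  shows "((\<lambda>x. \<Sum>a\<in>A. f a x) has_sum (\<Sum>a\<in>A. s a)) B"
  using assms
proof (induction A rule: finite_induct)
  case empty
  then show ?case by simp
next
  case (insert a A)
  then show ?case by (auto intro!: has_sum_add)
qed

text \<open>If all values had norm at least \<open>e > 0\<close>, sums over \<open>n\<close>-element
  sets would be at least \<open>n * e\<close>, hence unbounded. This later excludes the spectral
  parameter 0.\<close>

lemma zero_in_closure_range_summable:
  fixes f :: "'a \<Rightarrow> 'b::real_normed_vector"
  assumes inf: "infinite (UNIV :: 'a set)" and summ: "(\<lambda>v. norm (f v)) summable_on UNIV"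
  shows "0 \<in> closure (range f)"
proof (rule ccontr)
  assume "0 \<notin> closure (range f)"
  then obtain e where e: "e > 0" "\<And>v. norm (f v) \<ge> e"
    by (auto simp: closure_approachable not_less)
  define S where "S = (\<Sum>\<^sub>\<infinity>v. norm (f v))"
  obtain n :: nat where n: "real n * e > S"
    using reals_Archimedean3[OF e(1)] by blast
  obtain F :: "'a set" where F: "finite F" "card F = n"
    using infinite_arbitrarily_large[OF inf] by blast
  have "real n * e = (\<Sum>v\<in>F. e)" by (simp add: F)
  also have "\<dots> \<le> (\<Sum>v\<in>F. norm (f v))" by (rule sum_mono) (rule e)
  also have "\<dots> \<le> S" unfolding S_def by (rule finite_sum_le_infsum) (use F summ in auto)
  finally show False using n by simp
qed

lemma LinfI: "(\<And>v. norm (f v) \<le> K) \<Longrightarrow> f \<in> Linf"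
  by (auto simp: Linf_def bounded_iff)

lemma norm_le_Linf_norm: "f \<in> Linf \<Longrightarrow> norm (f v) \<le> Linf_norm f"
  unfolding Linf_norm_def Linf_def
  by (rule cSUP_upper) (auto simp: bounded_iff bdd_above_def)

lemma Linf_norm_le: "(\<And>v. norm (f v) \<le> K) \<Longrightarrow> Linf_norm f \<le> K"
  unfolding Linf_norm_def by (rule cSUP_least) auto

lemma Linf_bounded_opD:
  assumes "Linf_bounded_op A"
  shows "f \<in> Linf \<Longrightarrow> A f \<in> Linf"
    and "f \<in> Linf \<Longrightarrow> g \<in> Linf \<Longrightarrow> A (\<lambda>v. f v + g v) = (\<lambda>v. A f v + A g v)"
    and "f \<in> Linf \<Longrightarrow> A (\<lambda>v. c * f v) = (\<lambda>v. c * A f v)"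
    and "\<exists>K. \<forall>f\<in>Linf. Linf_norm (A f) \<le> K * Linf_norm f"
  using assms by (simp_all add: Linf_bounded_op_def)

lemma Linf_bounded_op_diff_scaled:
  assumes A: "Linf_bounded_op A"
  shows "Linf_bounded_op (\<lambda>f v. A f v - c * f v)"
proof -
  obtain K where K: "\<forall>f\<in>Linf. Linf_norm (A f) \<le> K * Linf_norm f"
    using Linf_bounded_opD(4)[OF A] ..
  have bd: "norm (A f v - c * f v) \<le> (K + norm c) * Linf_norm f" if f: "f \<in> Linf" for f v
  proof -
    have "norm (A f v) \<le> Linf_norm (A f)"
      by (intro norm_le_Linf_norm Linf_bounded_opD(1)[OF A] f)
    also have "\<dots> \<le> K * Linf_norm f" using K f by blast
    finally have "norm (A f v) \<le> K * Linf_norm f" .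
    moreover have "norm (c * f v) \<le> norm c * Linf_norm f"
      using norm_le_Linf_norm[OF f] by (simp add: norm_mult mult_left_mono)
    ultimately show ?thesis
      using norm_triangle_ineq4[of "A f v" "c * f v"] by (simp add: algebra_simps)
  qed
  have "(\<lambda>v. A f v - c * f v) \<in> Linf" if "f \<in> Linf" for f
    by (rule LinfI) (rule bd[OF that])
  moreover have "Linf_norm (\<lambda>v. A f v - c * f v) \<le> (K + norm c) * Linf_norm f"
    if "f \<in> Linf" for f
    by (rule Linf_norm_le) (rule bd[OF that])
  ultimately show ?thesis
    unfolding Linf_bounded_op_def by (intro conjI ballI allI exI[of _ "K + norm c"])
      (simp_all add: Linf_bounded_opD(2,3)[OF A] algebra_simps)
qed

section \<open>Rooted trees\<close>

locale rooted_tree =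
  fixes adj :: "'v \<Rightarrow> 'v \<Rightarrow> bool" and r :: 'v
  assumes tree: "is_tree adj"
begin

abbreviation path :: "'v \<Rightarrow> 'v list" where
  "path v \<equiv> tree_path adj r v"

abbreviation children :: "'v \<Rightarrow> 'v set" where
  "children u \<equiv> {v. v \<noteq> r \<and> parent adj r v = u}"

lemma adj_sym: "adj u v \<Longrightarrow> adj v u"
  using tree by (auto simp: is_tree_def dest: sympD)

lemma adj_irrefl: "\<not> adj v v"
  using tree by (auto simp: is_tree_def dest: irreflpD)

lemma is_path_path: "is_path adj r v (path v)"
  unfolding tree_path_def by (rule theI') (use tree in \<open>simp add: is_tree_def\<close>)

lemma path_eqI: "is_path adj r v p \<Longrightarrow> path v = p"
  using tree is_path_path unfolding is_tree_def by blast

lemma path_ne: "path v \<noteq> []" and hd_path: "hd (path v) = r" and last_path: "last (path v) = v"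
  and distinct_path: "distinct (path v)" and successively_path: "successively adj (path v)"
  using is_path_path[of v] by (auto simp: is_path_def)

lemma self_in_path: "v \<in> set (path v)"
  using path_ne last_path last_in_set by metis

text \<open>An initial segment of a path is itself a path, so uniqueness makes it the path to its
  last vertex.\<close>

lemma path_prefix:
  assumes "path v = xs @ u # ys"
  shows "path u = xs @ [u]"
proof (rule path_eqI)
  show "is_path adj r u (xs @ [u])"
    using hd_path[of v] distinct_path[of v] successively_path[of v] assms
    by (cases xs) (auto simp: is_path_def successively_append_iff successively_Cons hd_append split: if_splits)
qed

lemma in_path_append: "u \<in> set (path v) \<Longrightarrow> \<exists>ys. path v = path u @ ys"
  by (metis append.assoc append_Cons append_Nil path_prefix split_list)

text \<open>The next-to-last vertex of \<open>path v\<close> satisfies the description behind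
  \<open>parent\<close>; the work lies in its uniqueness.\<close>

lemma parent_props:
  assumes v: "v \<noteq> r"
  shows "path v = path (parent adj r v) @ [v]" and "adj v (parent adj r v)"
proof -
  define xs where "xs = butlast (path v)"
  have p: "path v = xs @ [v]"
    using path_ne last_path append_butlast_last_id unfolding xs_def by metis
  then have "xs \<noteq> []" using hd_path[of v] v by auto
  define u where "u = last xs"
  have xs: "xs = butlast xs @ [u]" using \<open>xs \<noteq> []\<close> by (simp add: u_def)
  then have "path v = butlast xs @ u # [v]" using p
    by (metis append.assoc append_Cons append_Nil)
  then have pu: "path u = xs" using path_prefix xs by metis
  have adj: "adj v u"
    using successively_path[of v] \<open>xs \<noteq> []\<close> adj_sym
    by (auto simp: p successively_append_iff u_def)
  have "parent adj r v = u"
    unfolding parent_def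
  proof (rule the_equality)
    show "adj v u \<and> u \<in> set (path v)"
      using adj p \<open>xs \<noteq> []\<close> by (simp add: u_def)
  next
    \<comment> \<open>For a neighbor \<open>w\<close> of \<open>v\<close> on the path,
      \<open>path w\<close> stops before \<open>v\<close>, so \<open>path w @ [v]\<close> is a path
      to \<open>v\<close>. Uniqueness of paths forces \<open>w\<close> to be the next-to-last
      vertex.\<close>
    fix w assume w: "adj v w \<and> w \<in> set (path v)"
    then obtain ys where ys: "path v = path w @ ys" using in_path_append by blast
    have "w \<noteq> v" using w adj_irrefl by auto
    then have "ys \<noteq> []" using ys last_path by (metis append_Nil2)
    then have "last ys = v" using ys last_path by (metis last_append)
    then have "v \<in> set ys" using \<open>ys \<noteq> []\<close> last_in_set by blast
    then have "v \<notin> set (path w)" using distinct_path[of v] ys by auto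
    then have "is_path adj r v (path w @ [v])"
      using w is_path_path[of w] adj_sym
      by (auto simp: is_path_def successively_append_iff)
    then have "path w = xs" using path_eqI p by fastforce
    then show "w = u" using last_path u_def by metis
  qed
  then show "path v = path (parent adj r v) @ [v]" "adj v (parent adj r v)"
    using pu p adj by auto
qed

lemma finite_children: "finite (children u)"
proof (rule finite_subset)
  show "children u \<subseteq> {w. adj u w}" using parent_props adj_sym by auto
  show "finite {w. adj u w}" using tree by (auto simp: is_tree_def)
qed

lemma sector_eq: "sector adj r u = {v. u \<in> set (path v)}"
  using self_in_path by (auto simp: sector_def descendant_def)

text \<open>A path from the root through \<open>u\<close> begins with \<open>path u\<close>, so it
  leaves \<open>u\<close> through at most one child, found at position
  \<open>length (path u)\<close>. Sums over children of path indicators thus have at most one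
  nonzero term.\<close>

lemma children_in_path:
  "children u \<inter> {w. w \<in> set (path v)} =
     (if u \<in> set (path v) \<and> u \<noteq> v then {path v ! length (path u)} else {})"
proof -
  have child: "u \<in> set (path v) \<and> u \<noteq> v \<and> w = path v ! length (path u)"
    if w: "w \<in> children u" "w \<in> set (path v)" for w
  proof -
    have pw: "path w = path u @ [w]" using w(1) parent_props(1) by auto
    obtain ys where ys: "path v = path w @ ys" using w(2) in_path_append by blast
    then have p: "path v = path u @ w # ys" using pw by simp
    then have "u \<noteq> v" by auto
    then show ?thesis using p self_in_path[of u] by auto
  qed
  moreover have "path v ! length (path u) \<in> children u \<inter> {w. w \<in> set (path v)}"
    if u: "u \<in> set (path v)" "u \<noteq> v"
  proof -
    obtain zs where zs: "path v = path u @ zs" using u(1) in_path_append by blast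
    with u(2) last_path obtain w ys where p: "path v = path u @ w # ys"
      by (metis append_Nil2 neq_Nil_conv)
    have pw: "path w = path u @ [w]" by (rule path_prefix[OF p])
    \<comment> \<open>The path to the root is \<open>[r]\<close>, while \<open>path u @ [w]\<close>
      has at least two entries.\<close>
    have "w \<noteq> r"
      using pw path_eqI[of r "[r]"] path_ne[of u] by (auto simp: is_path_def)
    then have "path (parent adj r w) = path u" using parent_props(1) pw by fastforce
    then have "parent adj r w = u" using last_path by metis
    then show ?thesis using p \<open>w \<noteq> r\<close> by auto
  qed
  ultimately show ?thesis by auto
qed

text \<open>Strictly before \<open>v\<close> on the path, the value 1 at \<open>u\<close> cancels
  against the one child on the path. At \<open>v\<close> no child is on the path, and off the path
  all terms vanish.\<close>

lemma nabla_path_indicator: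
  "nabla adj r (\<lambda>u. of_bool (u \<in> set (path v))) u = of_bool (u = v)"
  using self_in_path[of v] children_in_path[of u v]
  by (auto simp: nabla_def of_bool_def sum.If_cases[OF finite_children])

section \<open>The operators on a tree\<close>

text \<open>This presents \<open>Delta g\<close> as a superposition of path indicators with weights
  \<open>g v\<close>, summed over one index set for all \<open>u\<close>.\<close>

lemma Delta_eq: "Delta adj r g u = (\<Sum>\<^sub>\<infinity>v. of_bool (u \<in> set (path v)) * g v)"
  unfolding Delta_def sector_eq by (rule infsum_cong_neutral) auto

lemma nabla_Delta:
  assumes g: "g \<in> L1"
  shows "nabla adj r (Delta adj r g) u = g u"
proof -
  define k where "k u v = of_bool (u \<in> set (path v)) * g v" for u v
  have hs: "(k u has_sum Delta adj r g u) UNIV" for u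
  proof -
    have "(\<lambda>v. norm (k u v)) summable_on UNIV"
      by (rule Infinite_Sum.abs_summable_on_comparison_test'[where g = "\<lambda>v. norm (g v)"])
        (use g in \<open>auto simp: L1_def k_def\<close>)
    then have "k u summable_on UNIV" by (rule abs_summable_summable)
    then show ?thesis unfolding Delta_eq k_def by (rule has_sum_infsum)
  qed
  \<comment> \<open>Only finitely many children occur, so \<open>nabla\<close> may be applied inside
    the convergent sum, term by term.\<close>
  have "((\<lambda>v. k u v - (\<Sum>w\<in>children u. k w v)) has_sum nabla adj r (Delta adj r g) u) UNIV"
    unfolding nabla_def diff_conv_add_uminus
    by (intro has_sum_add has_sum_uminusI has_sum_finite_sum finite_children hs)
  moreover have "k u v - (\<Sum>w\<in>children u. k w v) = (if v = u then g u else 0)" for v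
  proof -
    have "k u v - (\<Sum>w\<in>children u. k w v) =
        nabla adj r (\<lambda>u. of_bool (u \<in> set (path v))) u * g v"
      by (simp add: nabla_def k_def left_diff_distrib sum_distrib_right)
    then show ?thesis by (auto simp: nabla_path_indicator)
  qed
  ultimately have "((\<lambda>v. if v = u then g u else 0) has_sum nabla adj r (Delta adj r g) u) UNIV"
    by simp
  moreover have "((\<lambda>v. if v = u then g u else 0) has_sum g u) UNIV"
    by (rule has_sum_finite_neutralI[of "{u}"]) auto
  ultimately show ?thesis by (rule has_sum_unique)
qed

section \<open>Boundedness of Toeplitz operators\<close>

lemma nabla_diff_scaled:
  "nabla adj r (\<lambda>v. f v - c * g v) u = nabla adj r f u - c * nabla adj r g u"
  by (simp add: nabla_def sum_subtractf sum_distrib_left algebra_simps)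

lemma norm_nabla_le:
  assumes "f \<in> Linf"
  shows "norm (nabla adj r f u) \<le> (1 + real (card (children u))) * Linf_norm f"
proof -
  have "norm (\<Sum>v\<in>children u. f v) \<le> real (card (children u)) * Linf_norm f"
    by (rule sum_norm_bound) (rule norm_le_Linf_norm[OF assms])
  then show ?thesis
    using norm_triangle_ineq4[of "f u" "\<Sum>v\<in>children u. f v"] norm_le_Linf_norm[OF assms, of u]
    by (simp add: nabla_def algebra_simps)
qed

definition symbol :: "('v \<Rightarrow> complex) \<Rightarrow> bool" where
  "symbol \<phi> \<longleftrightarrow> \<phi> \<in> L1 \<and> tree_deriv adj r \<phi> \<in> L1"

text \<open>The number of children may be unbounded, so summability of \<phi> does not suffice. The
  difference of \<phi> and its derivative is the backshift, which repeats the value at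
  \<open>u\<close> once for each child of \<open>u\<close>; its summability gives the weighted
  bound.\<close>

lemma summable_symbol_weighted:
  assumes "symbol \<phi>"
  shows "(\<lambda>u. norm (\<phi> u) * (1 + real (card (children u)))) summable_on UNIV"
proof -
  have L1: "(\<lambda>v. norm (\<phi> v)) summable_on UNIV" "(\<lambda>v. norm (tree_deriv adj r \<phi> v)) summable_on UNIV"
    using assms by (auto simp: symbol_def L1_def)
  have bs: "(\<lambda>v. norm (backshift adj r \<phi> v)) summable_on UNIV" (is "?b summable_on _")
  proof (rule Infinite_Sum.abs_summable_on_comparison_test')
    show "(\<lambda>v. norm (\<phi> v) + norm (tree_deriv adj r \<phi> v)) summable_on UNIV"
      by (rule summable_on_add[OF L1])
    show "norm (backshift adj r \<phi> v) \<le> norm (\<phi> v) + norm (tree_deriv adj r \<phi> v)" for v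
      using norm_triangle_ineq4[of "\<phi> v" "tree_deriv adj r \<phi> v"] by (simp add: tree_deriv_def)
  qed
  have "(\<lambda>u. norm (\<phi> u) * real (card (children u))) summable_on UNIV"
  proof (rule nonneg_bdd_above_summable_on)
    show "bdd_above (sum (\<lambda>u. norm (\<phi> u) * real (card (children u))) ` {F. F \<subseteq> UNIV \<and> finite F})"
    proof (rule bdd_aboveI2)
      fix F :: "'v set" assume "F \<in> {F. F \<subseteq> UNIV \<and> finite F}"
      then have F: "finite F" by simp
      have "(\<Sum>u\<in>F. norm (\<phi> u) * real (card (children u))) = (\<Sum>u\<in>F. \<Sum>v\<in>children u. ?b v)"
        by (intro sum.cong) (auto simp: backshift_def)
      \<comment> \<open>Distinct vertices have disjoint sets of children.\<close>
      also have "\<dots> = (\<Sum>v\<in>(\<Union>u\<in>F. children u). ?b v)"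
        by (rule sum.UNION_disjoint[symmetric]) (use F finite_children in auto)
      also have "\<dots> \<le> (\<Sum>\<^sub>\<infinity>v. ?b v)"
        by (rule finite_sum_le_infsum) (use F finite_children bs in auto)
      finally show "(\<Sum>u\<in>F. norm (\<phi> u) * real (card (children u))) \<le> (\<Sum>\<^sub>\<infinity>v. ?b v)" .
    qed
  qed simp
  from summable_on_add[OF L1(1) this] show ?thesis by (simp add: algebra_simps)
qed

lemma norm_symbol_nabla_le:
  assumes "f \<in> Linf"
  shows "norm (\<phi> u * nabla adj r f u)
    \<le> norm (\<phi> u) * (1 + real (card (children u))) * Linf_norm f"
  using mult_left_mono[OF norm_nabla_le[OF assms] norm_ge_zero[of "\<phi> u"]]
  by (simp add: norm_mult mult.assoc)

lemma symbol_nabla_L1: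
  assumes "symbol \<phi>" "f \<in> Linf"
  shows "(\<lambda>v. \<phi> v * nabla adj r f v) \<in> L1"
  unfolding L1_def mem_Collect_eq
  by (rule Infinite_Sum.abs_summable_on_comparison_test'[OF summable_on_cmult_left
        [OF summable_symbol_weighted[OF assms(1)], where c = "Linf_norm f"]])
    (rule norm_symbol_nabla_le[OF assms(2)])

lemma norm_Delta_le:
  assumes "g \<in> L1"
  shows "norm (Delta adj r g u) \<le> (\<Sum>\<^sub>\<infinity>v. norm (g v))"
proof -
  have g: "(\<lambda>v. norm (g v)) summable_on UNIV" using assms by (simp add: L1_def)
  then have s: "(\<lambda>v. norm (g v)) summable_on sector adj r u"
    by (rule summable_on_subset_banach) simp
  then have "norm (Delta adj r g u) \<le> (\<Sum>\<^sub>\<infinity>v\<in>sector adj r u. norm (g v))"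
    unfolding Delta_def by (rule norm_infsum_bound)
  also have "\<dots> \<le> (\<Sum>\<^sub>\<infinity>v. norm (g v))"
    by (rule infsum_mono_neutral) (use s g in auto)
  finally show ?thesis .
qed

lemma Delta_add:
  assumes "g \<in> L1" "h \<in> L1"
  shows "Delta adj r (\<lambda>v. g v + h v) u = Delta adj r g u + Delta adj r h u"
proof -
  have "k summable_on sector adj r u" if "k \<in> L1" for k :: "'v \<Rightarrow> complex"
  proof (rule summable_on_subset_banach)
    show "k summable_on UNIV" using that by (auto simp: L1_def intro: abs_summable_summable)
  qed simp
  then show ?thesis unfolding Delta_def using assms by (intro infsum_add) auto
qed

text \<open>Where \<open>g\<close> is not summable over the sector, both sides are 0, the default
  value of \<open>infsum\<close>.\<close>

lemma Delta_scale: "Delta adj r (\<lambda>v. c * g v) u = c * Delta adj r g u"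
  unfolding Delta_def by (rule infsum_cmult_right')

lemma toeplitz_bounded_op:
  assumes "symbol \<phi>"
  shows "Linf_bounded_op (toeplitz adj r \<phi>)"
proof -
  \<comment> \<open>Since \<open>nabla\<close> costs a factor of 1 plus the number of children, this
    weighted norm of \<phi> bounds the sum over every sector, uniformly in \<open>u\<close>.\<close>
  define K where "K = (\<Sum>\<^sub>\<infinity>u. norm (\<phi> u) * (1 + real (card (children u))))"
  have bd: "norm (toeplitz adj r \<phi> f u) \<le> K * Linf_norm f" if f: "f \<in> Linf" for f u
  proof -
    have L: "(\<lambda>v. \<phi> v * nabla adj r f v) \<in> L1" by (rule symbol_nabla_L1[OF assms f])
    then have "norm (toeplitz adj r \<phi> f u) \<le> (\<Sum>\<^sub>\<infinity>v. norm (\<phi> v * nabla adj r f v))"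
      unfolding toeplitz_def by (rule norm_Delta_le)
    also have "\<dots> \<le> (\<Sum>\<^sub>\<infinity>v. norm (\<phi> v) * (1 + real (card (children v))) * Linf_norm f)"
      by (rule infsum_mono)
        (use L norm_symbol_nabla_le[OF f] summable_symbol_weighted[OF assms] in
          \<open>auto simp: L1_def intro: summable_on_cmult_left\<close>)
    also have "\<dots> = K * Linf_norm f" unfolding K_def by (rule infsum_cmult_left')
    finally show ?thesis .
  qed
  have "toeplitz adj r \<phi> (\<lambda>v. f v + g v) = (\<lambda>v. toeplitz adj r \<phi> f v + toeplitz adj r \<phi> g v)"
    if "f \<in> Linf" "g \<in> Linf" for f g
  proof -
    have "nabla adj r (\<lambda>v. f v + g v) u = nabla adj r f u + nabla adj r g u" for u
      by (simp add: nabla_def sum.distrib)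
    then show ?thesis
      using that assms by (simp add: toeplitz_def fun_eq_iff distrib_left Delta_add symbol_nabla_L1)
  qed
  moreover have "toeplitz adj r \<phi> (\<lambda>v. c * f v) = (\<lambda>v. c * toeplitz adj r \<phi> f v)" for c f
  proof -
    have "nabla adj r (\<lambda>v. c * f v) u = c * nabla adj r f u" for u
      by (simp add: nabla_def sum_distrib_left right_diff_distrib)
    then show ?thesis by (simp add: toeplitz_def fun_eq_iff mult.left_commute Delta_scale)
  qed
  moreover have "toeplitz adj r \<phi> f \<in> Linf" if "f \<in> Linf" for f
    by (rule LinfI) (rule bd[OF that])
  moreover have "Linf_norm (toeplitz adj r \<phi> f) \<le> K * Linf_norm f" if "f \<in> Linf" for f
    by (rule Linf_norm_le) (rule bd[OF that])
  ultimately show ?thesis unfolding Linf_bounded_op_def by blast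
qed

section \<open>The spectrum\<close>

lemma toeplitz_path_indicator:
  "toeplitz adj r \<phi> (\<lambda>u. of_bool (u \<in> set (path v))) u = \<phi> v * of_bool (u \<in> set (path v))"
proof -
  have "toeplitz adj r \<phi> (\<lambda>u. of_bool (u \<in> set (path v))) u =
      (\<Sum>\<^sub>\<infinity>w. of_bool (u \<in> set (path w)) * (\<phi> w * of_bool (w = v)))"
    unfolding toeplitz_def Delta_eq nabla_path_indicator ..
  also have "\<dots> = (\<Sum>\<^sub>\<infinity>w\<in>{v}. of_bool (u \<in> set (path w)) * \<phi> w)"
    by (rule infsum_cong_neutral) auto
  finally show ?thesis by simp
qed

lemma closure_range_subset_spectrum: "closure (range \<phi>) \<subseteq> Linf_spectrum (toeplitz adj r \<phi>)"
proof
  fix z assume z: "z \<in> closure (range \<phi>)"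
  show "z \<in> Linf_spectrum (toeplitz adj r \<phi>)"
    unfolding Linf_spectrum_def mem_Collect_eq
  proof
    assume "Linf_invertible (\<lambda>f v. toeplitz adj r \<phi> f v - z * f v)"
    then obtain B where B: "Linf_bounded_op B"
      "\<And>f. f \<in> Linf \<Longrightarrow> B (\<lambda>v. toeplitz adj r \<phi> f v - z * f v) = f"
      by (auto simp: Linf_invertible_def)
    obtain K where K: "\<forall>f\<in>Linf. Linf_norm (B f) \<le> K * Linf_norm f"
      using Linf_bounded_opD(4)[OF B(1)] ..
    \<comment> \<open>A bounded inverse \<open>B\<close> must send \<open>(\<phi> v - z) * f\<close>
      back to the unit eigenvector \<open>f\<close>; evaluating at \<open>v\<close>, where
      \<open>f\<close> is 1, yields the bound, with \<open>K\<close> independent of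
      \<open>v\<close>.\<close>
    have bound: "1 \<le> norm (\<phi> v - z) * K" for v
    proof -
      define f :: "'v \<Rightarrow> complex" where "f = (\<lambda>u. of_bool (u \<in> set (path v)))"
      have f: "f \<in> Linf" by (rule LinfI[of _ 1]) (auto simp: f_def)
      have fv: "f v = 1" by (simp add: f_def self_in_path)
      have nf: "Linf_norm f = 1"
      proof (rule antisym)
        show "Linf_norm f \<le> 1" by (rule Linf_norm_le) (auto simp: f_def)
        show "1 \<le> Linf_norm f" using norm_le_Linf_norm[OF f, of v] fv by simp
      qed
      have "(\<lambda>u. toeplitz adj r \<phi> f u - z * f u) = (\<lambda>u. (\<phi> v - z) * f u)"
        by (auto simp: f_def toeplitz_path_indicator algebra_simps)
      then have "f = B (\<lambda>u. (\<phi> v - z) * f u)" using B(2)[OF f] by simp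
      also have "\<dots> = (\<lambda>u. (\<phi> v - z) * B f u)"
        by (rule Linf_bounded_opD(3)[OF B(1) f])
      finally have "1 = norm ((\<phi> v - z) * B f v)" using fv by (metis norm_one)
      also have "\<dots> = norm (\<phi> v - z) * norm (B f v)" by (rule norm_mult)
      also have "norm (B f v) \<le> Linf_norm (B f)"
        by (intro norm_le_Linf_norm Linf_bounded_opD(1)[OF B(1)] f)
      also have "Linf_norm (B f) \<le> K" using K f nf by force
      finally show ?thesis by (simp add: mult_left_mono)
    qed
    then have "K > 0"
      using norm_ge_zero[of "\<phi> r - z"] bound[of r] by (smt (verit) mult_nonneg_nonpos)
    then obtain v where "norm (\<phi> v - z) < 1 / K"
      using z unfolding closure_approachable dist_norm
      by (metis rangeE zero_less_divide_1_iff)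
    with \<open>K > 0\<close> bound[of v] show False by (simp add: pos_less_divide_eq)
  qed
qed

section \<open>Inversion off the closure of the range\<close>

text \<open>The equation for the symbols says \<open>(\<psi> - d)(\<phi> - c) = 1\<close>, with the constant \<open>cd = 1\<close> cancelled.\<close>

lemma toeplitz_shifted_inverse:
  assumes \<phi>: "symbol \<phi>" and f: "f \<in> Linf"
    and cd: "c * d = 1" and eq: "\<And>v. \<psi> v * \<phi> v - c * \<psi> v = d * \<phi> v"
  shows "toeplitz adj r \<psi> (\<lambda>v. toeplitz adj r \<phi> f v - c * f v) u
    - d * (toeplitz adj r \<phi> f u - c * f u) = f u"
proof -
  have "nabla adj r (\<lambda>v. toeplitz adj r \<phi> f v - c * f v) v = \<phi> v * nabla adj r f v - c * nabla adj r f v"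
    for v
    unfolding nabla_diff_scaled toeplitz_def by (simp add: nabla_Delta[OF symbol_nabla_L1[OF \<phi> f]])
  \<comment> \<open>With \<open>x\<close> the value of \<open>nabla f\<close>, the symbol equation
    turns the outer integrand into \<open>d\<close> times that of \<phi>.\<close>
  moreover have "\<psi> v * (\<phi> v * x - c * x) = d * (\<phi> v * x)" for v x
  proof -
    have "\<psi> v * (\<phi> v * x - c * x) = (\<psi> v * \<phi> v - c * \<psi> v) * x" by (simp add: algebra_simps)
    then show ?thesis by (simp add: eq)
  qed
  ultimately have "toeplitz adj r \<psi> (\<lambda>v. toeplitz adj r \<phi> f v - c * f v) u = d * toeplitz adj r \<phi> f u"
    by (simp add: toeplitz_def Delta_scale)
  moreover have "d * (toeplitz adj r \<phi> f u - c * f u) = d * toeplitz adj r \<phi> f u - c * d * f u"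
    by (simp add: algebra_simps)
  ultimately show ?thesis by (simp add: cd)
qed

text \<open>The new symbol is \<open>h \<circ> \<phi>\<close> with
  \<open>h x = x / (z * (x - z))\<close>. As \<open>h 0 = 0\<close> and the values of \<phi> keep a
  distance \<open>e\<close> from \<open>z\<close>, it is dominated by \<phi>; as \<open>h\<close> is
  Lipschitz at such values, its derivative is dominated by that of \<phi>.\<close>

lemma symbol_resolvent:
  assumes \<phi>: "symbol \<phi>" and z: "z \<notin> closure (range \<phi>)" "z \<noteq> 0"
  shows "symbol (\<lambda>v. \<phi> v / (z * (\<phi> v - z)))"
proof -
  define \<psi> where "\<psi> v = \<phi> v / (z * (\<phi> v - z))" for v
  obtain e where e: "e > 0" "\<And>v. norm (\<phi> v - z) \<ge> e"
    using z(1) by (auto simp: closure_approachable dist_norm not_less)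
  have ne: "\<phi> v \<noteq> z" for v
    using z(1) closure_subset[of "range \<phi>"] by auto
  have 1: "norm (\<psi> v) \<le> norm (\<phi> v) * (1 / (norm z * e))" for v
    unfolding \<psi>_def using e z(2) ne[of v]
    by (simp add: norm_divide norm_mult divide_left_mono mult_left_mono)
  have lip: "norm (\<psi> v - \<psi> w) \<le> norm (\<phi> v - \<phi> w) * (1 / (e * e))" for v w
  proof -
    \<comment> \<open>Since \<open>h x = 1 / (x - z) + 1 / z\<close>, the constant drops out of the
      difference.\<close>
    have "\<psi> v - \<psi> w = - (\<phi> v - \<phi> w) / ((\<phi> v - z) * (\<phi> w - z))"
      unfolding \<psi>_def using ne[of v] ne[of w] z(2) by (simp add: divide_simps) (simp add: algebra_simps)
    then have "norm (\<psi> v - \<psi> w) = norm (\<phi> v - \<phi> w) / (norm (\<phi> v - z) * norm (\<phi> w - z))"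
      by (simp add: norm_divide norm_mult norm_minus_commute)
    also have "\<dots> \<le> norm (\<phi> v - \<phi> w) / (e * e)"
      using e ne by (intro divide_left_mono mult_mono mult_pos_pos) simp_all
    finally show ?thesis by simp
  qed
  have "\<psi> \<in> L1"
    unfolding L1_def mem_Collect_eq
    by (rule Infinite_Sum.abs_summable_on_comparison_test'[OF summable_on_cmult_left 1])
      (use \<phi> in \<open>simp add: symbol_def L1_def\<close>)
  moreover have "tree_deriv adj r \<psi> \<in> L1"
  proof -
    \<comment> \<open>At the root the derivative is the function value, governed by the first
      constant; elsewhere it is a difference along an edge, governed by the Lipschitz
      constant.\<close>
    define C where "C = max (1 / (norm z * e)) (1 / (e * e))"
    have "norm (tree_deriv adj r \<psi> v) \<le> norm (tree_deriv adj r \<phi> v) * C" for v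
    proof (cases "v = r")
      case True
      have "norm (\<phi> v) * (1 / (norm z * e)) \<le> norm (\<phi> v) * C"
        by (rule mult_left_mono) (auto simp: C_def)
      with 1[of v] True show ?thesis by (simp add: tree_deriv_def backshift_def)
    next
      case False
      define w where "w = parent adj r v"
      have "norm (\<phi> v - \<phi> w) * (1 / (e * e)) \<le> norm (\<phi> v - \<phi> w) * C"
        by (rule mult_left_mono) (auto simp: C_def)
      with lip[of v w] False show ?thesis by (simp add: tree_deriv_def backshift_def w_def)
    qed
    note bd = this
    show ?thesis
      unfolding L1_def mem_Collect_eq
      by (rule Infinite_Sum.abs_summable_on_comparison_test'[OF summable_on_cmult_left bd])
        (use \<phi> in \<open>simp add: symbol_def L1_def\<close>)
  qed
  ultimately show ?thesis unfolding symbol_def \<psi>_def by blast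
qed

lemma spectrum_subset_closure_range:
  assumes inf: "infinite (UNIV :: 'v set)" and \<phi>: "symbol \<phi>"
  shows "Linf_spectrum (toeplitz adj r \<phi>) \<subseteq> closure (range \<phi>)"
proof
  fix z assume "z \<in> Linf_spectrum (toeplitz adj r \<phi>)"
  then have ninv: "\<not> Linf_invertible (\<lambda>f v. toeplitz adj r \<phi> f v - z * f v)"
    by (simp add: Linf_spectrum_def)
  show "z \<in> closure (range \<phi>)"
  proof (rule ccontr)
    assume z: "z \<notin> closure (range \<phi>)"
    moreover have "0 \<in> closure (range \<phi>)"
      by (rule zero_in_closure_range_summable[OF inf]) (use \<phi> in \<open>simp add: symbol_def L1_def\<close>)
    ultimately have z0: "z \<noteq> 0" by blast
    have ne: "\<phi> v \<noteq> z" for v using z closure_subset[of "range \<phi>"] by auto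
    define \<psi> where "\<psi> v = \<phi> v / (z * (\<phi> v - z))" for v
    have \<psi>: "symbol \<psi>" unfolding \<psi>_def by (rule symbol_resolvent[OF \<phi> z z0])
    have "\<psi> v * \<phi> v - z * \<psi> v = (1 / z) * \<phi> v" for v
    proof -
      have "\<psi> v * \<phi> v - z * \<psi> v = \<psi> v * (\<phi> v - z)" by (simp add: algebra_simps)
      also have "\<dots> = (1 / z) * \<phi> v" using ne[of v] z0 by (simp add: \<psi>_def)
      finally show ?thesis .
    qed
    \<comment> \<open>The second form exchanges the roles of \<phi> and \<psi>, with
      \<open>c = 1 / z\<close> and \<open>d = z\<close>, so the same lemma gives both the left and
      the right inverse.\<close>
    then have eqs: "\<psi> v * \<phi> v - z * \<psi> v = (1 / z) * \<phi> v" "\<phi> v * \<psi> v - (1 / z) * \<phi> v = z * \<psi> v" for v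
      by (simp_all add: algebra_simps)
    define B where "B f v = toeplitz adj r \<psi> f v - (1 / z) * f v" for f v
    have "Linf_bounded_op B"
      unfolding B_def by (intro Linf_bounded_op_diff_scaled toeplitz_bounded_op \<psi>)
    moreover have "B (\<lambda>v. toeplitz adj r \<phi> f v - z * f v) = f" if "f \<in> Linf" for f
      unfolding B_def fun_eq_iff using toeplitz_shifted_inverse[OF \<phi> that _ eqs(1)] z0 by simp
    moreover have "(\<lambda>v. toeplitz adj r \<phi> (B f) v - z * B f v) = f" if "f \<in> Linf" for f
      unfolding B_def fun_eq_iff using toeplitz_shifted_inverse[OF \<psi> that _ eqs(2)] z0 by simp
    ultimately have "Linf_invertible (\<lambda>f v. toeplitz adj r \<phi> f v - z * f v)"
      unfolding Linf_invertible_def by blast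
    with ninv show False by blast
  qed
qed

end

theorem theorem3p2:
  fixes adj :: "'v \<Rightarrow> 'v \<Rightarrow> bool"
    and r :: 'v
    and \<phi> :: "'v \<Rightarrow> complex"
  assumes "countable (UNIV :: 'v set)"
    and "infinite (UNIV :: 'v set)"
    and "is_tree adj"
    and "\<And>v. \<not> terminal_vertex adj v"
    and "\<phi> \<in> L1"
    and "tree_deriv adj r \<phi> \<in> L1"
  shows "Linf_bounded_op (toeplitz adj r \<phi>) \<and>
         Linf_spectrum (toeplitz adj r \<phi>) = closure (range \<phi>)"
proof -
  interpret rooted_tree adj r by unfold_locales (rule assms(3))
  have "symbol \<phi>" using assms(5,6) by (simp add: symbol_def)
  then show ?thesis
    using toeplitz_bounded_op closure_range_subset_spectrum
      spectrum_subset_closure_range[OF assms(2)] by blast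
qed

end
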